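(* If the Prime Ideal Theorem holds, then the functors $\mathbf P:\mathbf{CPervin}\to\mathbf{Priest}$ and $\mathbf{CUp}:\mathbf{Priest}\to\mathbf{CPervin}$ establish an isomorphism of categories between $\mathbf{Priest}$ (Priestley spaces) and $\mathbf{CPervin}$ ($T_0$ complete Pervin spaces).
   Context: Prime Ideal Theorem: every proper ideal of a bounded distributive lattice extends to a prime ideal. (The Axiom of Choice is not assumed.) A Pervin space is a pair $(X,\mathcal S)$ with $X$ a set and $\mathcal S$ a bounded sublattice of $\mathcal P(X)$. A morphism $(X,\mathcal S)\to(Y,\mathcal T)$ is a function $f$ with $f^{-1}(T)\in\mathcal S$ for all $T\in\mathcal T$. $\Omega_{\mathcal S}(X)$ is the topology generated by $\mathcal S$; $(X,\mathcal S)$ is $T_0$ if this topology is $T_0$. $f$ is dense if $f[X]$ is dense in $(Y,\Omega_{\mathcal T}(Y))$, and it is an extremal monomorphism if and only if it is injective and every $S\in\mathcal S$ is $f^{-1}(T)$ for some $T\in\mathcal T$. $(X,\mathcal S)$ is symmetric if $\mathcal S$ is a Boolean algebra. A symmetric Pervin space is complete if every dense extremal monomorphism from it into a $T_0$ symmetric Pervin space is an isomorphism. A Pervin space $(X,\mathcal S)$ is complete if $(X,\overline{\mathcal S})$ is complete, where $\overline{\mathcal S}$ is the Boolean subalgebra of $\mathcal P(X)$ generated by $\mathcal S$. $\mathbf{CPervin}$ is the full subcategory of Pervin spaces determined by the $T_0$ complete ones. A Priestley space is a compact topological space with a partial order $\leq$ on its points such that whenever $x\nleq y$ there is a clopen upset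 containing $x$ and omitting $y$. Morphisms of Priestley spaces are continuous monotone maps; the category is $\mathbf{Priest}$. For a Pervin space $(X,\mathcal S)$, $x\leq_{\mathcal S}y$ means that $x\in S$ implies $y\in S$ for all $S\in\mathcal S$. The functor $\mathbf P$ sends $(X,\mathcal S)$ to $(X,\Omega_{\overline{\mathcal S}}(X),\leq_{\mathcal S})$; the functor $\mathbf{CUp}$ sends a Priestley space $(X,\tau,\leq)$ to the set $X$ equipped with the lattice of its clopen upsets; both leave underlying functions unchanged. *)

theory Defs
  imports
    "HOL-Analysis.Analysis"
    "HOL-Algebra.Lattice"
begin

section \<open>The Prime Ideal Theorem\<close>

definition bounded_distributive_lattice :: "'l gorder \<Rightarrow> bool" where
  "bounded_distributive_lattice L \<longleftrightarrow>
     bounded_lattice L \<and>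
     (\<forall>x\<in>carrier L. \<forall>y\<in>carrier L. \<forall>z\<in>carrier L.
        x \<sqinter>\<^bsub>L\<^esub> (y \<squnion>\<^bsub>L\<^esub> z) = (x \<sqinter>\<^bsub>L\<^esub> y) \<squnion>\<^bsub>L\<^esub> (x \<sqinter>\<^bsub>L\<^esub> z))"

definition lattice_ideal :: "'l gorder \<Rightarrow> 'l set \<Rightarrow> bool" where
  "lattice_ideal L I \<longleftrightarrow>
     I \<subseteq> carrier L \<and> I \<noteq> {} \<and>
     (\<forall>x\<in>carrier L. \<forall>y\<in>I. x \<sqsubseteq>\<^bsub>L\<^esub> y \<longrightarrow> x \<in> I) \<and>
     (\<forall>x\<in>I. \<forall>y\<in>I. x \<squnion>\<^bsub>L\<^esub> y \<in> I)"

definition proper_ideal :: "'l gorder \<Rightarrow> 'l set \<Rightarrow> bool" where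
  "proper_ideal L I \<longleftrightarrow> lattice_ideal L I \<and> I \<noteq> carrier L"

definition prime_ideal :: "'l gorder \<Rightarrow> 'l set \<Rightarrow> bool" where
  "prime_ideal L I \<longleftrightarrow>
     proper_ideal L I \<and>
     (\<forall>x\<in>carrier L. \<forall>y\<in>carrier L. x \<sqinter>\<^bsub>L\<^esub> y \<in> I \<longrightarrow> x \<in> I \<or> y \<in> I)"

text \<open>HOL cannot quantify over types inside a formula, so the Prime Ideal Theorem is stated
  for all bounded distributive lattices whose carrier is a set of elements of the given type.\<close>

definition prime_ideal_theorem :: "'l itself \<Rightarrow> bool" where
  "prime_ideal_theorem _ \<longleftrightarrow>
     (\<forall>L :: 'l gorder. bounded_distributive_lattice L \<longrightarrow>
        (\<forall>I. proper_ideal L I \<longrightarrow> (\<exists>J. prime_ideal L J \<and> I \<subseteq> J)))"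


section \<open>Pervin spaces\<close>

type_synonym 'a pervin = "'a set \<times> 'a set set"

definition pervin_space :: "'a pervin \<Rightarrow> bool" where
  "pervin_space = (\<lambda>(X, S).
     S \<subseteq> Pow X \<and> {} \<in> S \<and> X \<in> S \<and>
     (\<forall>A\<in>S. \<forall>B\<in>S. A \<union> B \<in> S) \<and> (\<forall>A\<in>S. \<forall>B\<in>S. A \<inter> B \<in> S))"

text \<open>Morphisms are extensional functions (\<open>undefined\<close> outside the domain), so that equality
  in HOL is equality of functions between the underlying sets.\<close>

definition pervin_hom :: "'a pervin \<Rightarrow> 'b pervin \<Rightarrow> ('a \<Rightarrow> 'b) set" where
  "pervin_hom = (\<lambda>(X, S) (Y, T). {f \<in> X \<rightarrow>\<^sub>E Y. \<forall>B\<in>T. f -` B \<inter> X \<in> S})"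

definition pervin_iso :: "'a pervin \<Rightarrow> 'b pervin \<Rightarrow> ('a \<Rightarrow> 'b) \<Rightarrow> bool" where
  "pervin_iso A B f \<longleftrightarrow>
     f \<in> pervin_hom A B \<and>
     (\<exists>g \<in> pervin_hom B A. (\<forall>x\<in>fst A. g (f x) = x) \<and> (\<forall>y\<in>fst B. f (g y) = y))"

definition pervin_topology :: "'a pervin \<Rightarrow> 'a topology" where
  "pervin_topology = (\<lambda>(X, S). topology_generated_by S)"

definition pervin_T0 :: "'a pervin \<Rightarrow> bool" where
  "pervin_T0 A \<longleftrightarrow> t0_space (pervin_topology A)"

definition pervin_dense :: "'a pervin \<Rightarrow> 'b pervin \<Rightarrow> ('a \<Rightarrow> 'b) \<Rightarrow> bool" where
  "pervin_dense A B f \<longleftrightarrow> pervin_topology B closure_of (f ` fst A) = fst B"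

definition pervin_extremal_mono :: "'a pervin \<Rightarrow> 'b pervin \<Rightarrow> ('a \<Rightarrow> 'b) \<Rightarrow> bool" where
  "pervin_extremal_mono = (\<lambda>(X, S) (Y, T) f.
     f \<in> pervin_hom (X, S) (Y, T) \<and> inj_on f X \<and> (\<forall>A\<in>S. \<exists>B\<in>T. A = f -` B \<inter> X))"

text \<open>\<^term>\<open>algebra X S\<close> says that \<open>S\<close> is a Boolean subalgebra of the powerset of \<open>X\<close>.
  A bounded sublattice of the powerset is a Boolean algebra iff it is closed under complements
  in \<open>X\<close>, since complements in it are complements in the powerset.\<close>

definition pervin_symmetric :: "'a pervin \<Rightarrow> bool" where
  "pervin_symmetric = (\<lambda>(X, S). pervin_space (X, S) \<and> algebra X S)"

text \<open>The test spaces \<open>B\<close> range over the type \<open>'a set set\<close>. This loses no generality: if there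
  is a dense extremal monomorphism from \<open>(X, S)\<close> into a \<open>T\<^sub>0\<close> symmetric space \<open>(Y, T)\<close> of any
  type, then \<open>T\<close> is isomorphic to \<open>S\<close> and a point of \<open>Y\<close> is determined by the family of traces
  on \<open>X\<close> of the members of \<open>T\<close> containing it. Lemma \<open>pervin_complete_symmetric_any_type\<close> below
  proves the defining property for test spaces of arbitrary type.\<close>

definition pervin_complete_symmetric :: "'a pervin \<Rightarrow> bool" where
  "pervin_complete_symmetric A \<longleftrightarrow>
     pervin_symmetric A \<and>
     (\<forall>(B :: 'a set set pervin) f.
        pervin_symmetric B \<and> pervin_T0 B \<and> pervin_extremal_mono A B f \<and> pervin_dense A B f
        \<longrightarrow> pervin_iso A B f)"

definition boolean_closure :: "'a pervin \<Rightarrow> 'a set set" where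
  "boolean_closure = (\<lambda>(X, S). algebra X hull S)"

definition symmetrization :: "'a pervin \<Rightarrow> 'a pervin" where
  "symmetrization A = (fst A, boolean_closure A)"

definition pervin_complete :: "'a pervin \<Rightarrow> bool" where
  "pervin_complete A \<longleftrightarrow> pervin_space A \<and> pervin_complete_symmetric (symmetrization A)"

definition pervin_order :: "'a pervin \<Rightarrow> 'a rel" where
  "pervin_order = (\<lambda>(X, S). {(x, y) \<in> X \<times> X. \<forall>A\<in>S. x \<in> A \<longrightarrow> y \<in> A})"


section \<open>Priestley spaces\<close>

text \<open>The underlying set is the \<^const>\<open>topspace\<close> of the topology; \<^const>\<open>partial_order_on\<close>
  requires the order relation to be contained in the square of that set.\<close>

type_synonym 'a ordered_space = "'a topology \<times> 'a rel"

definition clopen_upsets :: "'a ordered_space \<Rightarrow> 'a set set" where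
  "clopen_upsets = (\<lambda>(\<tau>, r).
     {U. openin \<tau> U \<and> closedin \<tau> U \<and> (\<forall>x y. x \<in> U \<and> (x, y) \<in> r \<longrightarrow> y \<in> U)})"

definition priestley_space :: "'a ordered_space \<Rightarrow> bool" where
  "priestley_space = (\<lambda>(\<tau>, r).
     compact_space \<tau> \<and> partial_order_on (topspace \<tau>) r \<and>
     (\<forall>x\<in>topspace \<tau>. \<forall>y\<in>topspace \<tau>. (x, y) \<notin> r \<longrightarrow>
        (\<exists>U\<in>clopen_upsets (\<tau>, r). x \<in> U \<and> y \<notin> U)))"

definition priestley_hom :: "'a ordered_space \<Rightarrow> 'b ordered_space \<Rightarrow> ('a \<Rightarrow> 'b) set" where
  "priestley_hom = (\<lambda>(\<tau>, r) (\<sigma>, s).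
     {f \<in> topspace \<tau> \<rightarrow>\<^sub>E topspace \<sigma>.
        continuous_map \<tau> \<sigma> f \<and> (\<forall>(x, y)\<in>r. (f x, f y) \<in> s)})"


section \<open>Categories, functors and isomorphisms of categories\<close>

text \<open>Hom-sets are indexed by domain and codomain and need not be disjoint.\<close>

record ('o, 'm) cat =
  Ob :: "'o set"
  Hom :: "'o \<Rightarrow> 'o \<Rightarrow> 'm set"
  Ident :: "'o \<Rightarrow> 'm"
  Cmp :: "'o \<Rightarrow> 'o \<Rightarrow> 'o \<Rightarrow> 'm \<Rightarrow> 'm \<Rightarrow> 'm"  \<comment> \<open>\<open>Cmp A B C g f\<close> for \<open>f : A \<rightarrow> B\<close>, \<open>g : B \<rightarrow> C\<close>\<close>

definition is_category :: "('o, 'm) cat \<Rightarrow> bool" where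
  "is_category C \<longleftrightarrow>
     (\<forall>A\<in>Ob C. Ident C A \<in> Hom C A A) \<and>
     (\<forall>A\<in>Ob C. \<forall>B\<in>Ob C. \<forall>D\<in>Ob C. \<forall>f\<in>Hom C A B. \<forall>g\<in>Hom C B D.
        Cmp C A B D g f \<in> Hom C A D) \<and>
     (\<forall>A\<in>Ob C. \<forall>B\<in>Ob C. \<forall>f\<in>Hom C A B.
        Cmp C A A B f (Ident C A) = f \<and> Cmp C A B B (Ident C B) f = f) \<and>
     (\<forall>A\<in>Ob C. \<forall>B\<in>Ob C. \<forall>D\<in>Ob C. \<forall>E\<in>Ob C.
        \<forall>f\<in>Hom C A B. \<forall>g\<in>Hom C B D. \<forall>h\<in>Hom C D E.
          Cmp C A D E h (Cmp C A B D g f) = Cmp C A B E (Cmp C B D E h g) f)"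

definition full_subcategory :: "('o, 'm) cat \<Rightarrow> ('o \<Rightarrow> bool) \<Rightarrow> ('o, 'm) cat" where
  "full_subcategory C P = C\<lparr>Ob := {A \<in> Ob C. P A}\<rparr>"

record ('o, 'm, 'p, 'n) cat_functor =
  ObMap :: "'o \<Rightarrow> 'p"
  HomMap :: "'o \<Rightarrow> 'o \<Rightarrow> 'm \<Rightarrow> 'n"  \<comment> \<open>\<open>HomMap A B\<close> acts on morphisms \<open>A \<rightarrow> B\<close>\<close>

definition is_functor ::
  "('o, 'm) cat \<Rightarrow> ('p, 'n) cat \<Rightarrow> ('o, 'm, 'p, 'n) cat_functor \<Rightarrow> bool" where
  "is_functor C D F \<longleftrightarrow>
     is_category C \<and> is_category D \<and>
     (\<forall>A\<in>Ob C. ObMap F A \<in> Ob D) \<and>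
     (\<forall>A\<in>Ob C. \<forall>B\<in>Ob C. \<forall>f\<in>Hom C A B. HomMap F A B f \<in> Hom D (ObMap F A) (ObMap F B)) \<and>
     (\<forall>A\<in>Ob C. HomMap F A A (Ident C A) = Ident D (ObMap F A)) \<and>
     (\<forall>A\<in>Ob C. \<forall>B\<in>Ob C. \<forall>E\<in>Ob C. \<forall>f\<in>Hom C A B. \<forall>g\<in>Hom C B E.
        HomMap F A E (Cmp C A B E g f) =
          Cmp D (ObMap F A) (ObMap F B) (ObMap F E) (HomMap F B E g) (HomMap F A B f))"

definition left_inverse_functor ::
  "('o, 'm) cat \<Rightarrow> ('o, 'm, 'p, 'n) cat_functor \<Rightarrow> ('p, 'n, 'o, 'm) cat_functor \<Rightarrow> bool" where
  "left_inverse_functor C F G \<longleftrightarrow>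
     (\<forall>A\<in>Ob C. ObMap G (ObMap F A) = A) \<and>
     (\<forall>A\<in>Ob C. \<forall>B\<in>Ob C. \<forall>f\<in>Hom C A B.
        HomMap G (ObMap F A) (ObMap F B) (HomMap F A B f) = f)"

definition category_isomorphism ::
  "('o, 'm) cat \<Rightarrow> ('p, 'n) cat \<Rightarrow>
   ('o, 'm, 'p, 'n) cat_functor \<Rightarrow> ('p, 'n, 'o, 'm) cat_functor \<Rightarrow> bool" where
  "category_isomorphism C D F G \<longleftrightarrow>
     is_functor C D F \<and> is_functor D C G \<and>
     left_inverse_functor C F G \<and> left_inverse_functor D G F"


section \<open>The categories and functors of the duality\<close>

text \<open>A type \<open>'a\<close> plays the role of the universe: objects are the spaces whose points are
  elements of \<open>'a\<close>.\<close>

definition Pervin :: "('a pervin, 'a \<Rightarrow> 'a) cat" where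
  "Pervin = \<lparr>
     Ob = {A. pervin_space A},
     Hom = pervin_hom,
     Ident = (\<lambda>A. \<lambda>x\<in>fst A. x),
     Cmp = (\<lambda>A B C g f. compose (fst A) g f)\<rparr>"

definition CPervin :: "('a pervin, 'a \<Rightarrow> 'a) cat" where
  "CPervin = full_subcategory Pervin (\<lambda>A. pervin_T0 A \<and> pervin_complete A)"

definition Priest :: "('a ordered_space, 'a \<Rightarrow> 'a) cat" where
  "Priest = \<lparr>
     Ob = {A. priestley_space A},
     Hom = priestley_hom,
     Ident = (\<lambda>A. \<lambda>x\<in>topspace (fst A). x),
     Cmp = (\<lambda>A B C g f. compose (topspace (fst A)) g f)\<rparr>"

definition P_functor :: "('a pervin, 'a \<Rightarrow> 'a, 'a ordered_space, 'a \<Rightarrow> 'a) cat_functor" where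
  "P_functor = \<lparr>
     ObMap = (\<lambda>A. (pervin_topology (symmetrization A), pervin_order A)),
     HomMap = (\<lambda>A B f. f)\<rparr>"

definition CUp_functor :: "('a ordered_space, 'a \<Rightarrow> 'a, 'a pervin, 'a \<Rightarrow> 'a) cat_functor" where
  "CUp_functor = \<lparr>
     ObMap = (\<lambda>A. (topspace (fst A), clopen_upsets A)),
     HomMap = (\<lambda>A B f. f)\<rparr>"


section \<open>Completeness does not depend on the type of the test spaces\<close>

lemma pervin_topology_base:
  assumes "pervin_space (Y, T)" "openin (pervin_topology (Y, T)) U" "y \<in> U"
  shows "\<exists>B\<in>T. y \<in> B \<and> B \<subseteq> U"
proof -
  have "generate_topology_on T U"
    using assms(2) by (simp add: pervin_topology_def openin_topology_generated_by_iff)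
  then have "\<forall>y\<in>U. \<exists>B\<in>T. y \<in> B \<and> B \<subseteq> U"
  proof induction
    case Empty
    then show ?case by simp
  next
    case (Int a b)
    show ?case
    proof
      fix y assume "y \<in> a \<inter> b"
      then obtain A B where "A \<in> T" "B \<in> T" "y \<in> A" "y \<in> B" "A \<subseteq> a" "B \<subseteq> b"
        using Int by (metis IntD1 IntD2)
      moreover have "A \<inter> B \<in> T"
        using assms(1) \<open>A \<in> T\<close> \<open>B \<in> T\<close> by (simp add: pervin_space_def)
      ultimately show "\<exists>B\<in>T. y \<in> B \<and> B \<subseteq> a \<inter> b" by blast
    qed
  next
    case (UN K)
    then show ?case by (meson UnionE Union_upper subset_trans)
  next
    case (Basis s)
    then show ?case by blast
  qed
  then show ?thesis using assms(3) by blast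
qed

lemma pervin_topology_basic_open: "B \<in> T \<Longrightarrow> openin (pervin_topology (Y, T)) B"
  by (simp add: pervin_topology_def topology_generated_by_Basis)

lemma topspace_pervin_topology: "pervin_space (Y, T) \<Longrightarrow> topspace (pervin_topology (Y, T)) = Y"
  by (auto simp: pervin_topology_def pervin_space_def)

lemma pervin_T0_iff:
  assumes "pervin_space (Y, T)"
  shows "pervin_T0 (Y, T) \<longleftrightarrow> (\<forall>x\<in>Y. \<forall>y\<in>Y. x \<noteq> y \<longrightarrow> (\<exists>B\<in>T. (x \<in> B) \<noteq> (y \<in> B)))"
proof -
  have "(\<exists>U. openin (pervin_topology (Y, T)) U \<and> (x \<notin> U) = (y \<in> U)) \<longleftrightarrow>
        (\<exists>B\<in>T. (x \<in> B) \<noteq> (y \<in> B))" for x y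
    using pervin_topology_base[OF assms] pervin_topology_basic_open[of _ T Y]
    by (metis subsetD)
  then show ?thesis
    by (simp add: pervin_T0_def t0_space_def topspace_pervin_topology[OF assms])
qed

lemma pervin_dense_iff:
  assumes "pervin_space (Y, T)"
  shows "pervin_dense A (Y, T) f \<longleftrightarrow> (\<forall>B\<in>T. B \<noteq> {} \<longrightarrow> (\<exists>x\<in>fst A. f x \<in> B))"
proof -
  have sub: "B \<subseteq> Y" if "B \<in> T" for B using assms that by (auto simp: pervin_space_def)
  have "pervin_dense A (Y, T) f \<longleftrightarrow>
        (\<forall>y\<in>Y. \<forall>U. y \<in> U \<and> openin (pervin_topology (Y, T)) U \<longrightarrow> (\<exists>z\<in>f ` fst A. z \<in> U))"
    by (simp only: pervin_dense_def closure_of_def topspace_pervin_topology[OF assms] fst_conv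
        set_eq_iff mem_Collect_eq Bex_def Ball_def) blast
  also have "\<dots> \<longleftrightarrow> (\<forall>B\<in>T. B \<noteq> {} \<longrightarrow> (\<exists>x\<in>fst A. f x \<in> B))" (is "?l = ?r")
  proof
    assume l: ?l
    show ?r
    proof (intro ballI impI)
      fix B assume B: "B \<in> T" "B \<noteq> {}"
      then obtain y where "y \<in> B" by blast
      then have "\<exists>z\<in>f ` fst A. z \<in> B"
        using l sub[OF B(1)] pervin_topology_basic_open[OF B(1), of Y] by (meson subsetD)
      then show "\<exists>x\<in>fst A. f x \<in> B" by blast
    qed
  next
    assume r: ?r
    show ?l
    proof (intro ballI allI impI)
      fix y U assume "y \<in> Y" "y \<in> U \<and> openin (pervin_topology (Y, T)) U"
      then obtain B where "B \<in> T" "y \<in> B" "B \<subseteq> U" using pervin_topology_base[OF assms] by meson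
      then show "\<exists>z\<in>f ` fst A. z \<in> U" using r by blast
    qed
  qed
  finally show ?thesis .
qed

lemma pervin_complete_symmetric_any_type:
  fixes A :: "'a pervin" and B :: "'b pervin"
  assumes compl: "pervin_complete_symmetric A"
    and B: "pervin_symmetric B" "pervin_T0 B"
    and f: "pervin_extremal_mono A B f" "pervin_dense A B f"
  shows "pervin_iso A B f"
proof -
  obtain X S where A_eq: "A = (X, S)" by force
  obtain Y T where B_eq: "B = (Y, T)" by force
  have pT: "pervin_space (Y, T)" and algT: "algebra Y T"
    using B(1) by (auto simp: pervin_symmetric_def B_eq)
  interpret T: algebra Y T by (rule algT)
  have fE: "f \<in> X \<rightarrow>\<^sub>E Y" and fpre: "\<And>t. t \<in> T \<Longrightarrow> f -` t \<inter> X \<in> S" and finj: "inj_on f X"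
    and fext: "\<And>s. s \<in> S \<Longrightarrow> \<exists>t\<in>T. s = f -` t \<inter> X"
    using f(1) by (auto simp: pervin_extremal_mono_def pervin_hom_def A_eq B_eq)
  have dense: "\<exists>x\<in>X. f x \<in> t" if "t \<in> T" "t \<noteq> {}" for t
    using f(2) that by (simp add: pervin_dense_iff[OF pT] A_eq B_eq)
  have t0: "\<exists>t\<in>T. (x \<in> t) \<noteq> (y \<in> t)" if "x \<in> Y" "y \<in> Y" "x \<noteq> y" for x y
    using B(2) that by (simp add: pervin_T0_iff[OF pT] B_eq)
  define tr where "tr t = f -` t \<inter> X" for t
  have tr_sub: "t \<subseteq> u" if "t \<in> T" "u \<in> T" "tr t \<subseteq> tr u" for t u
  proof -
    have "t - u \<in> T" using that by blast
    then show ?thesis using dense[of "t - u"] that(3) by (auto simp: tr_def)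
  qed
  then have tr_inj: "t = u" if "t \<in> T" "u \<in> T" "tr t = tr u" for t u
    using that by (metis order_refl subset_antisym)
  define h where "h y = tr ` {t \<in> T. y \<in> t}" for y
  have h_mem: "tr t \<in> h y \<longleftrightarrow> y \<in> t" if "t \<in> T" for t y
    using that tr_inj by (auto simp: h_def)
  have h_inj: "inj_on h Y"
  proof (rule inj_onI, rule ccontr)
    fix x y assume "x \<in> Y" "y \<in> Y" "h x = h y" "x \<noteq> y"
    with t0 h_mem show False by metis
  qed
  define Y' where "Y' = h ` Y"
  define T' where "T' = (`) h ` T"
  have him: "h ` t \<in> T'" if "t \<in> T" for t using that by (simp add: T'_def)
  have alg': "algebra Y' T'"
    unfolding algebra_iff_Un
  proof (intro conjI ballI)
    show "T' \<subseteq> Pow Y'" using T.space_closed by (auto simp: T'_def Y'_def)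
    show "{} \<in> T'" using him[of "{}"] by simp
    fix a assume "a \<in> T'"
    then obtain t where t: "t \<in> T" "a = h ` t" by (auto simp: T'_def)
    have "Y' - a = h ` (Y - t)"
      using T.sets_into_space[OF t(1)] by (simp add: Y'_def t(2) inj_on_image_set_diff[OF h_inj])
    then show "Y' - a \<in> T'" using him t(1) by (metis T.compl_sets)
    fix b assume "b \<in> T'"
    then obtain u where u: "u \<in> T" "b = h ` u" by (auto simp: T'_def)
    show "a \<union> b \<in> T'" using him[of "t \<union> u"] t u by (simp add: image_Un T.Un)
  qed
  interpret T': algebra Y' T' by (rule alg')
  have p': "pervin_space (Y', T')"
    using T'.space_closed by (auto simp: pervin_space_def)
  define f' where "f' = restrict (h \<circ> f) X"
  have f'_im: "f' -` (h ` t) \<inter> X = tr t" if "t \<in> T" for t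
  proof (rule Set.set_eqI)
    fix x
    have "h (f x) \<in> h ` t \<longleftrightarrow> f x \<in> t" if "x \<in> X"
      using inj_on_image_mem_iff[OF h_inj] T.sets_into_space[OF \<open>t \<in> T\<close>] fE that
      by (metis PiE_mem)
    then show "x \<in> f' -` (h ` t) \<inter> X \<longleftrightarrow> x \<in> tr t"
      unfolding f'_def tr_def by (cases "x \<in> X") simp_all
  qed
  have hom': "f' \<in> pervin_hom (X, S) (Y', T')"
  proof -
    have "f' \<in> X \<rightarrow>\<^sub>E Y'" using fE by (auto simp: f'_def Y'_def)
    moreover have "f' -` a \<inter> X \<in> S" if "a \<in> T'" for a
      using that fpre f'_im by (auto simp: T'_def tr_def)
    ultimately show ?thesis by (simp add: pervin_hom_def)
  qed
  have "pervin_iso (X, S) (Y', T') f'"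
  proof -
    have "pervin_symmetric (Y', T')" using p' alg' by (simp add: pervin_symmetric_def)
    moreover have "pervin_T0 (Y', T')"
      unfolding pervin_T0_iff[OF p']
    proof (intro ballI impI)
      fix x' y' assume "x' \<in> Y'" "y' \<in> Y'" "x' \<noteq> y'"
      then obtain x y where xy: "x \<in> Y" "y \<in> Y" "x \<noteq> y" "x' = h x" "y' = h y"
        by (auto simp: Y'_def)
      then obtain t where t: "t \<in> T" "(x \<in> t) \<noteq> (y \<in> t)" using t0 by blast
      then have "(x' \<in> h ` t) \<noteq> (y' \<in> h ` t)"
        using inj_on_image_mem_iff[OF h_inj] T.sets_into_space[OF t(1)] xy by metis
      then show "\<exists>B\<in>T'. (x' \<in> B) \<noteq> (y' \<in> B)" using him t(1) by blast
    qed
    moreover have "pervin_extremal_mono (X, S) (Y', T') f'"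
    proof -
      have "inj_on f' X"
      proof (rule inj_onI)
        fix x y assume xy: "x \<in> X" "y \<in> X" "f' x = f' y"
        then have "h (f x) = h (f y)" by (simp add: f'_def)
        moreover have "f x \<in> Y" "f y \<in> Y" using fE xy by (auto dest: PiE_mem)
        ultimately have "f x = f y" using inj_onD[OF h_inj] by blast
        then show "x = y" using inj_onD[OF finj] xy by blast
      qed
      moreover have "\<exists>b\<in>T'. s = f' -` b \<inter> X" if "s \<in> S" for s
      proof -
        obtain t where t: "t \<in> T" "s = tr t" using fext \<open>s \<in> S\<close> by (auto simp: tr_def)
        then show ?thesis using f'_im[OF t(1)] him[OF t(1)] by blast
      qed
      ultimately show ?thesis
        using hom' by (simp add: pervin_extremal_mono_def)
    qed
    moreover have "pervin_dense (X, S) (Y', T') f'"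
      unfolding pervin_dense_iff[OF p']
    proof (intro ballI impI)
      fix a assume "a \<in> T'" "a \<noteq> {}"
      then obtain t where "t \<in> T" "a = h ` t" "t \<noteq> {}" by (auto simp: T'_def)
      moreover from this obtain x where "x \<in> X" "f x \<in> t" using dense by blast
      ultimately show "\<exists>x\<in>fst (X, S). f' x \<in> a" by (auto simp: f'_def)
    qed
    ultimately show ?thesis
      using compl unfolding pervin_complete_symmetric_def A_eq by blast
  qed
  then obtain g' where g': "g' \<in> pervin_hom (Y', T') (X, S)" "\<forall>y\<in>Y'. f' (g' y) = y"
    by (auto simp: pervin_iso_def)
  have surj: "f ` X = Y"
  proof
    show "f ` X \<subseteq> Y" using fE by (auto dest: PiE_mem)
    show "Y \<subseteq> f ` X"
    proof
      fix y assume y: "y \<in> Y"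
      then have hy: "h y \<in> Y'" by (simp add: Y'_def)
      then have x: "g' (h y) \<in> X" using g'(1) by (auto simp: pervin_hom_def)
      then have "h (f (g' (h y))) = h y" using x bspec[OF g'(2) hy] by (simp add: f'_def)
      moreover have "f (g' (h y)) \<in> Y" using fE x by (rule PiE_mem)
      ultimately have "f (g' (h y)) = y" using inj_onD[OF h_inj] y by blast
      then show "y \<in> f ` X" using x by (metis imageI)
    qed
  qed
  define g where "g = restrict (inv_into X f) Y"
  have gf: "g (f x) = x" if "x \<in> X" for x
    using that surj finj by (auto simp: g_def)
  have gX: "g y \<in> X" and fg: "f (g y) = y" if "y \<in> Y" for y
    using that surj by (auto simp: g_def inv_into_into f_inv_into_f)
  have "g -` s \<inter> Y \<in> T" if "s \<in> S" for s
  proof -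
    obtain t where t: "t \<in> T" "s = f -` t \<inter> X" using fext \<open>s \<in> S\<close> by blast
    have "g -` s \<inter> Y = t" using t T.sets_into_space[OF t(1)] gX fg by auto
    then show ?thesis using t(1) by simp
  qed
  then have "g \<in> pervin_hom (Y, T) (X, S)"
    using gX by (auto simp: pervin_hom_def g_def)
  moreover have "f \<in> pervin_hom (X, S) (Y, T)"
    using f(1) by (simp add: pervin_extremal_mono_def A_eq B_eq)
  ultimately show ?thesis
    unfolding pervin_iso_def A_eq B_eq using gf fg by auto
qed

end

theory Submission
  imports Defs
begin

text \<open>
  Both functors keep the underlying functions, so the theorem is about objects: a \<open>T\<^sub>0\<close> complete
  Pervin space and a Priestley space have to determine each other. Everything rests on the fact
  that a \<open>T\<^sub>0\<close> symmetric Pervin space is complete iff its topology is compact.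

  Completeness implies compactness: a prime ideal of the Boolean algebra \<open>S\<close> that does not consist
  of the members of \<open>S\<close> omitting some given point would allow one new point to be added to the space,
  and the inclusion into the enlarged space would be a dense extremal monomorphism that is not
  surjective. So in a complete space every prime ideal is given by
  a point (\<open>complete_prime_ideal_has_point\<close>). The members of \<open>S\<close> that are covered by finitely many
  sets from a cover without finite subcover form a proper ideal; the Prime Ideal Theorem extends it
  to a prime ideal, and the point of that prime ideal is not covered
  (\<open>complete_imp_compact_space\<close>). This is the only use of the Prime Ideal Theorem.

  Compactness implies completeness: a \<open>T\<^sub>0\<close> symmetric space is Hausdorff, so the image of a compact
  space under a dense morphism is both closed and dense, and the morphism is surjective
  (\<open>compact_space_imp_complete\<close>).

  That the two object maps are mutually inverse is then a compactness argument
  (\<open>compact_clopen_lattice_separates\<close>): a lattice of clopen sets that separates the points of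
  two compact sets also separates the two sets. Applied to a clopen upset and its complement it shows
  that every clopen upset of \<open>P(X, S)\<close> lies in \<open>S\<close>; applied to a point and a closed set it shows
  that the clopen upsets of a Priestley space generate, together with their complements, the whole
  topology.
\<close>

section \<open>Lattices of sets\<close>

lemma pervin_space_finite_Union:
  assumes "pervin_space (X, S)" "finite F" "F \<subseteq> S"
  shows "\<Union>F \<in> S"
  using assms(2,3) by (induction F) (use assms(1) in \<open>auto simp: pervin_space_def\<close>)

lemma pervin_space_finite_Inter:
  assumes "pervin_space (X, S)" "finite F" "F \<subseteq> S"
  shows "X \<inter> \<Inter>F \<in> S"
  using assms(2,3)
proof (induction F)
  case empty
  then show ?case using assms(1) by (simp add: pervin_space_def)
next
  case (insert A F)
  have "X \<inter> \<Inter>(insert A F) = A \<inter> (X \<inter> \<Inter>F)" by auto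
  then show ?case using insert assms(1) by (simp add: pervin_space_def)
qed

lemma algebra_imp_pervin_space:
  assumes "algebra X S"
  shows "pervin_space (X, S)"
proof -
  interpret algebra X S by (rule assms)
  show ?thesis using space_closed by (auto simp: pervin_space_def)
qed

lemma pervin_symmetric_iff_algebra: "pervin_symmetric (X, S) \<longleftrightarrow> algebra X S"
  using algebra_imp_pervin_space by (auto simp: pervin_symmetric_def)

text \<open>The record form of an ordered set, to which the Prime Ideal Theorem applies. Joins and meets
  of such a record are chosen bounds with respect to the order; for a lattice of sets they are
  unions and intersections.\<close>

definition set_gorder :: "'a set set \<Rightarrow> 'a set gorder" where
  "set_gorder S = \<lparr>carrier = S, eq = (=), le = (\<subseteq>)\<rparr>"

lemma set_gorder_simps [simp]:
  "carrier (set_gorder S) = S" "(a \<sqsubseteq>\<^bsub>set_gorder S\<^esub> b) = (a \<subseteq> b)"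
  by (simp_all add: set_gorder_def)

lemma partial_order_set_gorder: "partial_order (set_gorder S)"
  by unfold_locales (auto simp: set_gorder_def)

lemma
  assumes "pervin_space (X, S)" "a \<in> S" "b \<in> S"
  shows is_lub_set_gorder: "is_lub (set_gorder S) (a \<union> b) {a, b}"
    and is_glb_set_gorder: "is_glb (set_gorder S) (a \<inter> b) {a, b}"
    and join_set_gorder: "a \<squnion>\<^bsub>set_gorder S\<^esub> b = a \<union> b"
    and meet_set_gorder: "a \<sqinter>\<^bsub>set_gorder S\<^esub> b = a \<inter> b"
proof -
  interpret partial_order "set_gorder S" by (rule partial_order_set_gorder)
  have *: "a \<union> b \<in> S" "a \<inter> b \<in> S" using assms by (auto simp: pervin_space_def)
  show lub: "is_lub (set_gorder S) (a \<union> b) {a, b}"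
    using assms * by (auto simp: least_def Upper_def)
  show glb: "is_glb (set_gorder S) (a \<inter> b) {a, b}"
    using assms * by (auto simp: greatest_def Lower_def)
  show "a \<squnion>\<^bsub>set_gorder S\<^esub> b = a \<union> b"
    unfolding join_def sup_def using lub least_unique by (metis (mono_tags, lifting) someI_ex)
  show "a \<sqinter>\<^bsub>set_gorder S\<^esub> b = a \<inter> b"
    unfolding meet_def inf_def using glb greatest_unique by (metis (mono_tags, lifting) someI_ex)
qed

lemma bounded_distributive_lattice_set_gorder:
  assumes "pervin_space (X, S)"
  shows "bounded_distributive_lattice (set_gorder S)"
proof -
  interpret partial_order "set_gorder S" by (rule partial_order_set_gorder)
  have S: "S \<subseteq> Pow X" "{} \<in> S" "X \<in> S" "\<And>a b. a \<in> S \<Longrightarrow> b \<in> S \<Longrightarrow> a \<union> b \<in> S"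
    "\<And>a b. a \<in> S \<Longrightarrow> b \<in> S \<Longrightarrow> a \<inter> b \<in> S"
    using assms by (auto simp: pervin_space_def)
  have "bounded_lattice (set_gorder S)"
  proof
    show "\<exists>s. is_lub (set_gorder S) s {x, y}"
      if "x \<in> carrier (set_gorder S)" "y \<in> carrier (set_gorder S)" for x y
      using is_lub_set_gorder[OF assms] that by auto
    show "\<exists>s. is_glb (set_gorder S) s {x, y}"
      if "x \<in> carrier (set_gorder S)" "y \<in> carrier (set_gorder S)" for x y
      using is_glb_set_gorder[OF assms] that by auto
    have "least (set_gorder S) {} (carrier (set_gorder S))" using S by (auto simp: least_def)
    then show "\<exists>x. least (set_gorder S) x (carrier (set_gorder S))" ..
    have "greatest (set_gorder S) X (carrier (set_gorder S))" using S by (auto simp: greatest_def)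
    then show "\<exists>x. greatest (set_gorder S) x (carrier (set_gorder S))" ..
  qed
  then show ?thesis
    using S by (auto simp: bounded_distributive_lattice_def join_set_gorder[OF assms]
        meet_set_gorder[OF assms])
qed

lemma lattice_ideal_set_gorder_iff:
  assumes "pervin_space (X, S)"
  shows "lattice_ideal (set_gorder S) I \<longleftrightarrow>
     I \<subseteq> S \<and> I \<noteq> {} \<and> (\<forall>a\<in>S. \<forall>b\<in>I. a \<subseteq> b \<longrightarrow> a \<in> I) \<and> (\<forall>a\<in>I. \<forall>b\<in>I. a \<union> b \<in> I)"
  unfolding lattice_ideal_def using join_set_gorder[OF assms] by (auto simp: subset_iff)

text \<open>In a Boolean algebra the complement of a prime ideal is an ultrafilter, so the ideal behaves
  like the family of the sets that omit some point; the last two properties are what makes the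
  one-point extension below a Boolean algebra.\<close>

lemma prime_ideal_of_algebra:
  assumes "algebra X S" "prime_ideal (set_gorder S) J"
  shows "J \<subseteq> S" "{} \<in> J" "X \<notin> J"
    and "\<And>a b. a \<in> S \<Longrightarrow> b \<in> S \<Longrightarrow> a \<union> b \<in> J \<longleftrightarrow> a \<in> J \<and> b \<in> J"
    and "\<And>a. a \<in> S \<Longrightarrow> X - a \<in> J \<longleftrightarrow> a \<notin> J"
proof -
  interpret algebra X S by (rule assms(1))
  have ps: "pervin_space (X, S)" by (rule algebra_imp_pervin_space[OF assms(1)])
  have J: "J \<subseteq> S" "J \<noteq> {}" "J \<noteq> S"
    and down: "\<And>a b. a \<in> S \<Longrightarrow> b \<in> J \<Longrightarrow> a \<subseteq> b \<Longrightarrow> a \<in> J"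
    and un: "\<And>a b. a \<in> J \<Longrightarrow> b \<in> J \<Longrightarrow> a \<union> b \<in> J"
    using assms(2) by (auto simp: prime_ideal_def proper_ideal_def lattice_ideal_set_gorder_iff[OF ps])
  have prime: "a \<in> J \<or> b \<in> J" if "a \<in> S" "b \<in> S" "a \<inter> b \<in> J" for a b
    using assms(2) that by (simp add: prime_ideal_def meet_set_gorder[OF ps])
  show "J \<subseteq> S" by (rule J)
  show empty: "{} \<in> J" using J down by (metis all_not_in_conv empty_sets empty_subsetI)
  show top: "X \<notin> J" using J down sets_into_space by (metis subsetI subset_antisym)
  show "a \<union> b \<in> J \<longleftrightarrow> a \<in> J \<and> b \<in> J" if "a \<in> S" "b \<in> S" for a b
    using that un down by (metis Un_upper1 Un_upper2)
  show "X - a \<in> J \<longleftrightarrow> a \<notin> J" if "a \<in> S" for a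
  proof -
    have "a \<inter> (X - a) = {}" "a \<union> (X - a) = X" using sets_into_space[OF that] by auto
    then show ?thesis using prime[OF that compl_sets[OF that]] empty top un by metis
  qed
qed


section \<open>Complete spaces are the compact ones\<close>

text \<open>If the prime ideal \<open>J\<close> came from no point, it could be added to the space as a point \<open>None\<close>
  that lies in exactly those members of the algebra that are not in \<open>J\<close>. The enlarged space is
  \<open>T\<^sub>0\<close> because \<open>J\<close> differs from all the ideals given by points, and the old points are dense in it
  because \<open>{} \<in> J\<close>.\<close>

lemma complete_prime_ideal_has_point:
  assumes compl: "pervin_complete_symmetric (X, S)" and t0: "pervin_T0 (X, S)"
    and J: "prime_ideal (set_gorder S) J"
  shows "\<exists>x\<in>X. J = {a \<in> S. x \<notin> a}"
proof (rule ccontr)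
  assume "\<not> ?thesis"
  then have no_point: "\<And>x. x \<in> X \<Longrightarrow> J \<noteq> {a \<in> S. x \<notin> a}" by blast
  have alg: "algebra X S"
    using compl by (simp add: pervin_complete_symmetric_def pervin_symmetric_def)
  interpret algebra X S by (rule alg)
  note J = prime_ideal_of_algebra[OF alg J]
  \<comment> \<open>The member of the enlarged algebra whose trace on the old points is \<open>a\<close>.\<close>
  define ext where "ext a = Some ` a \<union> (if a \<in> J then {} else {None})" for a
  define Y where "Y = insert None (Some ` X)"
  define T where "T = ext ` S"
  have Some_ext [simp]: "Some x \<in> ext a \<longleftrightarrow> x \<in> a" for x a by (auto simp: ext_def)
  have None_ext [simp]: "None \<in> ext a \<longleftrightarrow> a \<notin> J" for a by (auto simp: ext_def)
  have algT: "algebra Y T"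
    unfolding algebra_iff_Un
  proof (intro conjI ballI)
    show "T \<subseteq> Pow Y"
      using sets_into_space by (auto simp: T_def Y_def ext_def split: if_splits)
    have "ext {} = {}" using J(2) by (simp add: ext_def)
    then show "{} \<in> T" unfolding T_def by (metis empty_sets imageI)
    fix t assume "t \<in> T"
    then obtain a where a: "a \<in> S" "t = ext a" by (auto simp: T_def)
    have "Y - ext a = ext (X - a)"
      using J(5)[OF a(1)] by (auto simp: Y_def ext_def)
    then show "Y - t \<in> T" using a by (simp add: T_def compl_sets)
    fix u assume "u \<in> T"
    then obtain b where b: "b \<in> S" "u = ext b" by (auto simp: T_def)
    have "ext a \<union> ext b = ext (a \<union> b)"
      using J(4)[OF a(1) b(1)] by (auto simp: ext_def)
    then show "t \<union> u \<in> T" using a b by (simp add: T_def Un)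
  qed
  note psT = algebra_imp_pervin_space[OF algT]
  have T0: "pervin_T0 (Y, T)"
    unfolding pervin_T0_iff[OF psT]
  proof (intro ballI impI)
    have old: "\<exists>t\<in>T. (Some x \<in> t) \<noteq> (Some y \<in> t)" if "x \<in> X" "y \<in> X" "x \<noteq> y" for x y
      using t0 that unfolding pervin_T0_iff[OF algebra_imp_pervin_space[OF alg]]
      by (simp add: T_def)
    have new: "\<exists>t\<in>T. (Some x \<in> t) \<noteq> (None \<in> t)" if "x \<in> X" for x
      using no_point[OF that] J(1) by (auto simp: T_def)
    fix p q assume pq: "p \<in> Y" "q \<in> Y" "p \<noteq> q"
    show "\<exists>t\<in>T. (p \<in> t) \<noteq> (q \<in> t)"
    proof (cases p)
      case None
      then obtain y where "q = Some y" "y \<in> X" using pq by (auto simp: Y_def)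
      then show ?thesis using new None by metis
    next
      case p: (Some x)
      then have x: "x \<in> X" using pq(1) by (auto simp: Y_def)
      show ?thesis
      proof (cases q)
        case None
        then show ?thesis using new[OF x] p by simp
      next
        case (Some y)
        then show ?thesis using old[OF x, of y] p pq by (auto simp: Y_def)
      qed
    qed
  qed
  define f where "f = restrict Some X"
  have pre: "f -` ext a \<inter> X = a" if "a \<in> S" for a
    using sets_into_space[OF that] by (auto simp: f_def)
  have hom: "f \<in> pervin_hom (X, S) (Y, T)"
    using pre by (auto simp: pervin_hom_def T_def Y_def f_def)
  have "\<forall>a\<in>S. \<exists>t\<in>T. a = f -` t \<inter> X"
    using pre by (metis T_def imageI)
  moreover have "inj_on f X" by (simp add: f_def inj_on_def)
  ultimately have emb: "pervin_extremal_mono (X, S) (Y, T) f"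
    using hom by (simp add: pervin_extremal_mono_def)
  have dense: "pervin_dense (X, S) (Y, T) f"
    unfolding pervin_dense_iff[OF psT]
  proof (intro ballI impI)
    fix t assume t: "t \<in> T" "t \<noteq> {}"
    then obtain a where a: "a \<in> S" "t = ext a" by (auto simp: T_def)
    then have "a \<noteq> {}" using t J(2) by (auto simp: ext_def)
    then show "\<exists>x\<in>fst (X, S). f x \<in> t"
      using a sets_into_space[OF a(1)] by (auto simp: f_def)
  qed
  have "pervin_iso (X, S) (Y, T) f"
    using pervin_complete_symmetric_any_type[OF compl _ T0 emb dense] algT
    by (simp add: pervin_symmetric_iff_algebra)
  then obtain g where g: "g \<in> pervin_hom (Y, T) (X, S)" "\<forall>y\<in>Y. f (g y) = y"
    by (auto simp: pervin_iso_def)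
  have "None \<in> Y" by (simp add: Y_def)
  then have "g None \<in> X" "f (g None) = None" using g by (auto simp: pervin_hom_def)
  then show False by (simp add: f_def)
qed

text \<open>Finitely many members of a cover without finite subcover never cover \<open>X\<close>, so the sets they
  do cover form a proper ideal. A prime ideal above it consists of the sets omitting some point
  \<open>x\<close>. But \<open>x\<close> has a basic neighbourhood inside one member of the cover, and this
  neighbourhood belongs to the ideal.\<close>

lemma complete_imp_compact_space:
  fixes X :: "'a set"
  assumes pit: "prime_ideal_theorem TYPE('a set)"
    and compl: "pervin_complete_symmetric (X, S)" and t0: "pervin_T0 (X, S)"
  shows "compact_space (pervin_topology (X, S))"
proof -
  have alg: "algebra X S"
    using compl by (simp add: pervin_complete_symmetric_def pervin_symmetric_def)
  interpret algebra X S by (rule alg)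
  note ps = algebra_imp_pervin_space[OF alg]
  note top = topspace_pervin_topology[OF ps]
  show ?thesis
    unfolding compact_space_alt top
  proof (intro allI impI, elim conjE, rule ccontr)
    fix \<U> assume op: "\<forall>U\<in>\<U>. openin (pervin_topology (X, S)) U" and cov: "X \<subseteq> \<Union>\<U>"
      and "\<not> (\<exists>F. finite F \<and> F \<subseteq> \<U> \<and> X \<subseteq> \<Union>F)"
    then have nofin: "\<And>F. finite F \<Longrightarrow> F \<subseteq> \<U> \<Longrightarrow> \<not> X \<subseteq> \<Union>F" by blast
    define I where "I = {a \<in> S. \<exists>F. finite F \<and> F \<subseteq> \<U> \<and> a \<subseteq> \<Union>F}"
    have II: "a \<in> I" if "a \<in> S" "finite F" "F \<subseteq> \<U>" "a \<subseteq> \<Union>F" for a F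
      unfolding I_def using that by (intro CollectI conjI exI)
    have IE: "\<exists>F. finite F \<and> F \<subseteq> \<U> \<and> a \<subseteq> \<Union>F" if "a \<in> I" for a
      using that unfolding I_def by (elim CollectE conjE)
    have "lattice_ideal (set_gorder S) I"
      unfolding lattice_ideal_set_gorder_iff[OF ps]
    proof (intro conjI ballI impI)
      show sub: "I \<subseteq> S" by (auto simp: I_def)
      show "I \<noteq> {}" using II[of "{}" "{}"] by auto
      show "a \<in> I" if ab: "a \<in> S" "b \<in> I" "a \<subseteq> b" for a b
      proof -
        obtain F where "finite F" "F \<subseteq> \<U>" "b \<subseteq> \<Union>F" using IE[OF ab(2)] by metis
        then show ?thesis using II[OF ab(1)] subset_trans[OF ab(3)] by metis
      qed
      fix a b assume ab: "a \<in> I" "b \<in> I"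
      obtain F G where "finite F" "F \<subseteq> \<U>" "a \<subseteq> \<Union>F" "finite G" "G \<subseteq> \<U>" "b \<subseteq> \<Union>G"
        using IE[OF ab(1)] IE[OF ab(2)] by metis
      moreover have "a \<union> b \<in> S" using sub ab by auto
      ultimately show "a \<union> b \<in> I" by (intro II[of _ "F \<union> G"]) auto
    qed
    moreover have "X \<notin> I" using nofin IE by metis
    ultimately have "proper_ideal (set_gorder S) I"
      by (auto simp: proper_ideal_def)
    then obtain J where J: "prime_ideal (set_gorder S) J" "I \<subseteq> J"
      using pit bounded_distributive_lattice_set_gorder[OF ps]
      unfolding prime_ideal_theorem_def by blast
    obtain x where x: "x \<in> X" "J = {a \<in> S. x \<notin> a}"
      using complete_prime_ideal_has_point[OF compl t0 J(1)] by blast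
    obtain U where U: "U \<in> \<U>" "x \<in> U" using cov x(1) by blast
    then obtain a where a: "a \<in> S" "x \<in> a" "a \<subseteq> U"
      using pervin_topology_base[OF ps] op by meson
    then have "a \<in> I" using U by (intro II[of _ "{U}"]) auto
    then show False using J(2) x(2) a(2) by blast
  qed
qed

lemma pervin_hom_continuous_map:
  assumes "pervin_space (X, S)" "pervin_space (Y, T)" "f \<in> pervin_hom (X, S) (Y, T)"
  shows "continuous_map (pervin_topology (X, S)) (pervin_topology (Y, T)) f"
proof -
  have "openin (pervin_topology (X, S)) (f -` B \<inter> X)" if "B \<in> T" for B
    using assms(3) that by (auto simp: pervin_hom_def intro: pervin_topology_basic_open)
  moreover have "pervin_topology (Y, T) = topology_generated_by T" by (simp add: pervin_topology_def)
  moreover have "f ` X \<subseteq> \<Union>T" using assms(2,3) by (auto simp: pervin_hom_def pervin_space_def)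
  ultimately show ?thesis
    using topspace_pervin_topology[OF assms(1)]
    by (simp add: \<open>pervin_topology (Y, T) = _\<close> continuous_on_generated_topo_iff)
qed

lemma algebra_closedin_pervin_topology:
  assumes "algebra X S" "a \<in> S"
  shows "closedin (pervin_topology (X, S)) a"
proof -
  interpret algebra X S by (rule assms(1))
  show ?thesis
    using sets_into_space[OF assms(2)] pervin_topology_basic_open[OF compl_sets[OF assms(2)]]
    by (simp add: closedin_def topspace_pervin_topology[OF algebra_imp_pervin_space[OF assms(1)]])
qed

lemma symmetric_T0_Hausdorff_space:
  assumes alg: "algebra X S" and t0: "pervin_T0 (X, S)"
  shows "Hausdorff_space (pervin_topology (X, S))"
  unfolding Hausdorff_space_def topspace_pervin_topology[OF algebra_imp_pervin_space[OF alg]]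
proof (intro allI impI, elim conjE)
  interpret algebra X S by (rule alg)
  fix x y assume xy: "x \<in> X" "y \<in> X" "x \<noteq> y"
  then obtain a where a: "a \<in> S" "(x \<in> a) \<noteq> (y \<in> a)"
    using t0 unfolding pervin_T0_iff[OF algebra_imp_pervin_space[OF alg]] by blast
  have op: "openin (pervin_topology (X, S)) a" "openin (pervin_topology (X, S)) (X - a)"
    using a(1) compl_sets by (auto intro: pervin_topology_basic_open)
  have "disjnt a (X - a)" "disjnt (X - a) a" by (auto simp: disjnt_def)
  then show "\<exists>U V. openin (pervin_topology (X, S)) U \<and> openin (pervin_topology (X, S)) V \<and>
      x \<in> U \<and> y \<in> V \<and> disjnt U V"
    using op a(2) xy by (metis DiffI)
qed

text \<open>An extremal monomorphism carries the initial structure, so its inverse function is a morphism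
  as soon as it exists.\<close>

lemma surj_extremal_mono_imp_iso:
  assumes "pervin_space (Y, T)" "pervin_extremal_mono (X, S) (Y, T) f" "f ` X = Y"
  shows "pervin_iso (X, S) (Y, T) f"
proof -
  have hom: "f \<in> pervin_hom (X, S) (Y, T)" and inj: "inj_on f X"
    and ext: "\<And>a. a \<in> S \<Longrightarrow> \<exists>b\<in>T. a = f -` b \<inter> X"
    using assms(2) by (auto simp: pervin_extremal_mono_def)
  define g where "g = restrict (inv_into X f) Y"
  have gf: "g (f x) = x" if "x \<in> X" for x using that assms(3) inj by (auto simp: g_def)
  have fg: "g y \<in> X" "f (g y) = y" if "y \<in> Y" for y
    using that assms(3) by (auto simp: g_def inv_into_into f_inv_into_f)
  have "g -` a \<inter> Y \<in> T" if "a \<in> S" for a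
  proof -
    obtain b where b: "b \<in> T" "a = f -` b \<inter> X" using ext \<open>a \<in> S\<close> by blast
    moreover from b(1) have "b \<subseteq> Y" using assms(1) by (auto simp: pervin_space_def)
    ultimately have "g -` a \<inter> Y = b" using fg by auto
    then show ?thesis using b(1) by simp
  qed
  then have "g \<in> pervin_hom (Y, T) (X, S)" using fg by (auto simp: pervin_hom_def g_def)
  then show ?thesis using hom gf fg by (auto simp: pervin_iso_def)
qed

text \<open>Compact subsets of a Hausdorff space are closed, which forces a dense image of \<open>X\<close> to be
  everything.\<close>

lemma compact_space_imp_complete:
  assumes alg: "algebra X S" and cpt: "compact_space (pervin_topology (X, S))"
  shows "pervin_complete_symmetric (X, S)"
  unfolding pervin_complete_symmetric_def
proof (intro conjI allI impI)
  show "pervin_symmetric (X, S)" using alg by (simp add: pervin_symmetric_iff_algebra)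
  fix B :: "'a set set pervin" and f
  assume "pervin_symmetric B \<and> pervin_T0 B \<and>
    pervin_extremal_mono (X, S) B f \<and> pervin_dense (X, S) B f"
  then have symB: "pervin_symmetric B" and T0: "pervin_T0 B"
    and emb: "pervin_extremal_mono (X, S) B f" and dense: "pervin_dense (X, S) B f"
    by auto
  obtain Y T where B: "B = (Y, T)" by force
  have algT: "algebra Y T" using symB by (simp add: B pervin_symmetric_iff_algebra)
  note ps = algebra_imp_pervin_space[OF alg] and psT = algebra_imp_pervin_space[OF algT]
  have "f \<in> pervin_hom (X, S) (Y, T)" using emb by (simp add: B pervin_extremal_mono_def)
  then have "compactin (pervin_topology (Y, T)) (f ` X)"
    using image_compactin pervin_hom_continuous_map[OF ps psT] cpt
    by (metis compact_space_def topspace_pervin_topology[OF ps])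
  then have "closedin (pervin_topology (Y, T)) (f ` X)"
    using symmetric_T0_Hausdorff_space[OF algT] T0 B compactin_imp_closedin by blast
  then have "f ` X = Y"
    using dense by (simp add: B pervin_dense_def closure_of_closedin)
  then show "pervin_iso (X, S) B f"
    using surj_extremal_mono_imp_iso[OF psT] emb B by blast
qed


section \<open>Separation by clopen sets in compact spaces\<close>

text \<open>Two rounds of compactness. For fixed \<open>x\<close> in \<open>K\<close>, the complements of the members of \<open>S\<close>
  containing \<open>x\<close> cover \<open>L\<close>, and a finite intersection separates \<open>x\<close> from \<open>L\<close>; these
  intersections, as \<open>x\<close> varies, cover \<open>K\<close>, and a finite union separates \<open>K\<close> from \<open>L\<close>.\<close>

lemma compact_clopen_lattice_separates:
  assumes ps: "pervin_space (topspace \<tau>, S)"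
    and clopen: "\<And>A. A \<in> S \<Longrightarrow> openin \<tau> A \<and> closedin \<tau> A"
    and K: "compactin \<tau> K" and L: "compactin \<tau> L"
    and sep: "\<And>x y. x \<in> K \<Longrightarrow> y \<in> L \<Longrightarrow> \<exists>A\<in>S. x \<in> A \<and> y \<notin> A"
  shows "\<exists>A\<in>S. K \<subseteq> A \<and> L \<inter> A = {}"
proof -
  have point: "\<exists>A\<in>S. x \<in> A \<and> L \<inter> A = {}" if x: "x \<in> K" for x
  proof -
    let ?\<U> = "(\<lambda>A. topspace \<tau> - A) ` {A \<in> S. x \<in> A}"
    have "\<forall>U\<in>?\<U>. openin \<tau> U" using clopen by auto
    moreover have "L \<subseteq> \<Union>?\<U>" using sep[OF x] compactin_subset_topspace[OF L] by blast
    ultimately obtain F where F: "finite F" "F \<subseteq> ?\<U>" "L \<subseteq> \<Union>F"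
      using L unfolding compactin_def by meson
    then obtain G where G: "finite G" "G \<subseteq> {A \<in> S. x \<in> A}" "F = (\<lambda>A. topspace \<tau> - A) ` G"
      by (meson finite_subset_image)
    let ?A = "topspace \<tau> \<inter> \<Inter>G"
    have "?A \<in> S" using pervin_space_finite_Inter[OF ps] G by blast
    moreover have "x \<in> ?A" using G(2) x compactin_subset_topspace[OF K] by auto
    moreover have "L \<inter> ?A = {}" using F(3) G(3) by auto
    ultimately show ?thesis by blast
  qed
  let ?\<U> = "{A \<in> S. L \<inter> A = {}}"
  have "\<forall>U\<in>?\<U>. openin \<tau> U" using clopen by auto
  moreover have "K \<subseteq> \<Union>?\<U>" using point by blast
  ultimately obtain F where F: "finite F" "F \<subseteq> ?\<U>" "K \<subseteq> \<Union>F"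
    using K unfolding compactin_def by meson
  then have "\<Union>F \<in> S" using pervin_space_finite_Union[OF ps] by blast
  moreover have "L \<inter> \<Union>F = {}" using F(2) by blast
  ultimately show ?thesis using F(3) by blast
qed


section \<open>The Boolean algebra generated by a lattice of sets\<close>

lemma algebra_boolean_closure:
  assumes "S \<subseteq> Pow X"
  shows "algebra X (boolean_closure (X, S))"
proof -
  have "algebra X (Pow X)" by (auto simp: algebra_iff_Un)
  then show ?thesis
    using assms unfolding boolean_closure_def case_prod_conv hull_def
    by (simp add: algebra_iff_Un) blast
qed

lemma pervin_space_boolean_closure:
  "pervin_space (X, S) \<Longrightarrow> pervin_space (X, boolean_closure (X, S))"
  by (rule algebra_imp_pervin_space, rule algebra_boolean_closure) (simp add: pervin_space_def)

lemma boolean_closure_superset: "S \<subseteq> boolean_closure (X, S)"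
  by (simp add: boolean_closure_def hull_subset)

lemma boolean_closure_least: "S \<subseteq> A \<Longrightarrow> algebra X A \<Longrightarrow> boolean_closure (X, S) \<subseteq> A"
  by (simp add: boolean_closure_def hull_minimal)

text \<open>The sets with preimage in the Boolean closure of \<open>S\<close> form a Boolean algebra, because taking
  preimages preserves the Boolean operations.\<close>

lemma pervin_hom_boolean_closure:
  assumes X: "pervin_space (X, S)" and f: "f \<in> pervin_hom (X, S) (Y, T)"
    and Y: "pervin_space (Y, T)"
  shows "f \<in> pervin_hom (X, boolean_closure (X, S)) (Y, boolean_closure (Y, T))"
proof -
  have fE: "f \<in> X \<rightarrow>\<^sub>E Y" and pre: "\<And>B. B \<in> T \<Longrightarrow> f -` B \<inter> X \<in> S"
    using f by (auto simp: pervin_hom_def)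
  interpret algebra X "boolean_closure (X, S)"
    by (rule algebra_boolean_closure) (use X in \<open>simp add: pervin_space_def\<close>)
  let ?A = "{B \<in> Pow Y. f -` B \<inter> X \<in> boolean_closure (X, S)}"
  have "algebra Y ?A"
    unfolding algebra_iff_Un
  proof (intro conjI ballI)
    fix B assume B: "B \<in> ?A"
    have "f -` (Y - B) \<inter> X = X - (f -` B \<inter> X)" using fE by auto
    then show "Y - B \<in> ?A" using B by auto
    fix C assume C: "C \<in> ?A"
    have "f -` (B \<union> C) \<inter> X = (f -` B \<inter> X) \<union> (f -` C \<inter> X)" by auto
    then show "B \<union> C \<in> ?A" using B C by auto
  qed auto
  moreover have "T \<subseteq> ?A"
    using pre boolean_closure_superset[of S X] Y by (auto simp: pervin_space_def)
  ultimately have "boolean_closure (Y, T) \<subseteq> ?A" by (rule boolean_closure_least[rotated])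
  then show ?thesis using fE by (auto simp: pervin_hom_def)
qed

lemma pervin_T0_boolean_closure:
  assumes "pervin_space (X, S)" "pervin_T0 (X, S)"
  shows "pervin_T0 (X, boolean_closure (X, S))"
proof -
  show ?thesis
    using assms pervin_space_boolean_closure[OF assms(1)] boolean_closure_superset[of S X]
    by (simp add: pervin_T0_iff) (meson subsetD)
qed


section \<open>From complete Pervin spaces to Priestley spaces\<close>

text \<open>The topology generated by \<open>S\<close> and the complements of its members is known as the patch
  topology.\<close>

locale complete_pervin =
  fixes X :: "'a set" and S
  assumes ps: "pervin_space (X, S)" and t0: "pervin_T0 (X, S)"
    and compl: "pervin_complete (X, S)"
    and pit: "prime_ideal_theorem TYPE('a set)"
begin

abbreviation "patch \<equiv> pervin_topology (X, boolean_closure (X, S))"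

lemma alg: "algebra X (boolean_closure (X, S))"
  by (rule algebra_boolean_closure) (use ps in \<open>simp add: pervin_space_def\<close>)

lemma topspace_patch: "topspace patch = X"
  by (rule topspace_pervin_topology[OF algebra_imp_pervin_space[OF alg]])

lemma compact_patch: "compact_space patch"
  using complete_imp_compact_space[OF pit _ pervin_T0_boolean_closure[OF ps t0]] compl
  by (simp add: pervin_complete_def symmetrization_def)

lemma clopen_patch: "A \<in> S \<Longrightarrow> openin patch A \<and> closedin patch A"
  using boolean_closure_superset[of S X] algebra_closedin_pervin_topology[OF alg]
    pervin_topology_basic_open by blast

lemma clopen_upset_of_lattice: "S \<subseteq> clopen_upsets (patch, pervin_order (X, S))"
  using clopen_patch by (auto simp: clopen_upsets_def pervin_order_def)

lemma priestley_space_patch: "priestley_space (patch, pervin_order (X, S))"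
proof -
  have "partial_order_on X (pervin_order (X, S))"
    using t0 unfolding pervin_T0_iff[OF ps] partial_order_on_def preorder_on_def
    by (auto simp: pervin_order_def refl_on_def trans_def antisym_def)
  moreover have "\<exists>U\<in>clopen_upsets (patch, pervin_order (X, S)). x \<in> U \<and> y \<notin> U"
    if "x \<in> X" "y \<in> X" "(x, y) \<notin> pervin_order (X, S)" for x y
    using that clopen_upset_of_lattice by (auto simp: pervin_order_def)
  ultimately show ?thesis
    using compact_patch by (simp add: priestley_space_def topspace_patch)
qed

text \<open>A point of a clopen upset \<open>U\<close> is not below any point outside \<open>U\<close>, which by definition of
  the order means that a member of \<open>S\<close> separates them; compactness makes one member of \<open>S\<close>
  separate \<open>U\<close> from its complement, and that member is \<open>U\<close> itself.\<close>

lemma clopen_upsets_patch: "clopen_upsets (patch, pervin_order (X, S)) = S"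
proof
  show "clopen_upsets (patch, pervin_order (X, S)) \<subseteq> S"
  proof
    fix U assume "U \<in> clopen_upsets (patch, pervin_order (X, S))"
    then have U: "openin patch U" "closedin patch U"
      and up: "\<And>x y. x \<in> U \<Longrightarrow> (x, y) \<in> pervin_order (X, S) \<Longrightarrow> y \<in> U"
      by (auto simp: clopen_upsets_def)
    have UX: "U \<subseteq> X" using openin_subset[OF U(1)] topspace_patch by simp
    have "closedin patch (X - U)" using U(1) topspace_patch by (metis closedin_diff closedin_topspace)
    then have "compactin patch U" "compactin patch (X - U)"
      using U(2) compact_patch closedin_compact_space by auto
    moreover have "\<exists>A\<in>S. x \<in> A \<and> y \<notin> A" if "x \<in> U" "y \<in> X - U" for x y
      using up[of x y] that UX by (auto simp: pervin_order_def)
    ultimately obtain A where A: "A \<in> S" "U \<subseteq> A" "(X - U) \<inter> A = {}"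
      using compact_clopen_lattice_separates[of patch S U "X - U"] ps clopen_patch topspace_patch
      by metis
    then have "U = A" using ps by (auto simp: pervin_space_def)
    then show "U \<in> S" using A(1) by simp
  qed
qed (rule clopen_upset_of_lattice)

end

lemma pervin_hom_imp_priestley_hom:
  assumes X: "pervin_space (X, S)" and Y: "pervin_space (Y, T)"
    and f: "f \<in> pervin_hom (X, S) (Y, T)"
  shows "f \<in> priestley_hom
     (pervin_topology (X, boolean_closure (X, S)), pervin_order (X, S))
     (pervin_topology (Y, boolean_closure (Y, T)), pervin_order (Y, T))"
proof -
  note bX = pervin_space_boolean_closure[OF X] and bY = pervin_space_boolean_closure[OF Y]
  have "continuous_map (pervin_topology (X, boolean_closure (X, S)))
      (pervin_topology (Y, boolean_closure (Y, T))) f"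
    by (rule pervin_hom_continuous_map[OF bX bY pervin_hom_boolean_closure[OF X f Y]])
  moreover have "(f x, f y) \<in> pervin_order (Y, T)" if "(x, y) \<in> pervin_order (X, S)" for x y
    using that f by (fastforce simp: pervin_order_def pervin_hom_def)
  ultimately show ?thesis
    using f by (auto simp: priestley_hom_def topspace_pervin_topology[OF bX]
        topspace_pervin_topology[OF bY] pervin_hom_def)
qed


section \<open>From Priestley spaces to complete Pervin spaces\<close>

lemma priestley_order_subset: "priestley_space (\<tau>, r) \<Longrightarrow> r \<subseteq> topspace \<tau> \<times> topspace \<tau>"
  by (auto simp: priestley_space_def partial_order_on_def preorder_on_def refl_on_def)

lemma pervin_space_clopen_upsets:
  assumes "priestley_space (\<tau>, r)"
  shows "pervin_space (topspace \<tau>, clopen_upsets (\<tau>, r))"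
  using priestley_order_subset[OF assms]
  by (auto simp: pervin_space_def clopen_upsets_def dest: openin_subset)

locale priestley =
  fixes \<tau> :: "'a topology" and r
  assumes priestley: "priestley_space (\<tau>, r)"
begin

abbreviation "\<C> \<equiv> boolean_closure (topspace \<tau>, clopen_upsets (\<tau>, r))"

lemma order_r: "partial_order_on (topspace \<tau>) r"
  using priestley by (simp add: priestley_space_def)

lemma order_separated:
  "x \<in> topspace \<tau> \<Longrightarrow> y \<in> topspace \<tau> \<Longrightarrow> (x, y) \<notin> r \<Longrightarrow> \<exists>U\<in>clopen_upsets (\<tau>, r). x \<in> U \<and> y \<notin> U"
  using priestley by (simp add: priestley_space_def)

lemma alg: "algebra (topspace \<tau>) \<C>"
  by (rule algebra_boolean_closure)
    (use pervin_space_clopen_upsets[OF priestley] in \<open>simp add: pervin_space_def\<close>)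

lemma clopen_\<C>:
  assumes "A \<in> \<C>"
  shows "openin \<tau> A \<and> closedin \<tau> A"
proof -
  have "algebra (topspace \<tau>) {A. openin \<tau> A \<and> closedin \<tau> A}"
    by (auto simp: algebra_iff_Un dest: openin_subset)
  then have "\<C> \<subseteq> {A. openin \<tau> A \<and> closedin \<tau> A}"
    by (rule boolean_closure_least[rotated]) (auto simp: clopen_upsets_def)
  then show ?thesis using assms by blast
qed

text \<open>Antisymmetry says that at least one of \<open>x\<close>, \<open>y\<close> is not below the other. If it is only
  \<open>y\<close> that is not below \<open>x\<close>, the separating upset contains the wrong point, and its complement
  serves instead.\<close>

lemma \<C>_separates:
  assumes "x \<in> topspace \<tau>" "y \<in> topspace \<tau>" "x \<noteq> y"
  shows "\<exists>A\<in>\<C>. x \<in> A \<and> y \<notin> A"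
proof -
  interpret algebra "topspace \<tau>" \<C> by (rule alg)
  have sub: "clopen_upsets (\<tau>, r) \<subseteq> \<C>" by (rule boolean_closure_superset)
  have "(x, y) \<notin> r \<or> (y, x) \<notin> r"
    using order_r assms(3) by (auto simp: partial_order_on_def antisym_def)
  then show ?thesis
  proof
    assume "(x, y) \<notin> r"
    then show ?thesis using order_separated assms sub by blast
  next
    assume "(y, x) \<notin> r"
    then obtain U where "U \<in> clopen_upsets (\<tau>, r)" "y \<in> U" "x \<notin> U"
      using order_separated assms by blast
    then have "topspace \<tau> - U \<in> \<C>" "x \<in> topspace \<tau> - U" "y \<notin> topspace \<tau> - U"
      using sub assms by auto
    then show ?thesis by blast
  qed
qed

text \<open>For a point \<open>x\<close> of an open set \<open>U\<close>, compactness of the complement of \<open>U\<close> yields a member of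
  \<open>\<C>\<close> that contains \<open>x\<close> and lies inside \<open>U\<close>, so \<open>\<C>\<close> is a base of \<open>\<tau>\<close>.\<close>

lemma pervin_topology_\<C>: "pervin_topology (topspace \<tau>, \<C>) = \<tau>"
  unfolding topology_eq
proof (intro allI iffI)
  note ps = algebra_imp_pervin_space[OF alg]
  fix U assume U: "openin (pervin_topology (topspace \<tau>, \<C>)) U"
  show "openin \<tau> U"
  proof (subst openin_subopen, rule ballI)
    fix x assume "x \<in> U"
    then obtain A where "A \<in> \<C>" "x \<in> A" "A \<subseteq> U" using pervin_topology_base[OF ps U] by metis
    then show "\<exists>A. openin \<tau> A \<and> x \<in> A \<and> A \<subseteq> U" using clopen_\<C> by metis
  qed
next
  note ps = algebra_imp_pervin_space[OF alg]
  fix U assume U: "openin \<tau> U"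
  have "closedin \<tau> (topspace \<tau> - U)" using U by blast
  then have cpt: "compactin \<tau> (topspace \<tau> - U)"
    using priestley by (simp add: priestley_space_def closedin_compact_space)
  show "openin (pervin_topology (topspace \<tau>, \<C>)) U"
  proof (subst openin_subopen, rule ballI)
    fix x assume x: "x \<in> U"
    then have xt: "x \<in> topspace \<tau>" using openin_subset[OF U] by auto
    then have "compactin \<tau> {x}" by (simp add: finite_imp_compactin)
    moreover have "\<exists>A\<in>\<C>. z \<in> A \<and> y \<notin> A" if "z \<in> {x}" "y \<in> topspace \<tau> - U" for z y
      using \<C>_separates[of x y] that x xt by auto
    ultimately obtain A where A: "A \<in> \<C>" "{x} \<subseteq> A" "(topspace \<tau> - U) \<inter> A = {}"
      using compact_clopen_lattice_separates[OF ps clopen_\<C> _ cpt, of "{x}"] by metis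
    moreover have "A \<subseteq> topspace \<tau>" using clopen_\<C>[OF A(1)] openin_subset by metis
    ultimately have "x \<in> A" "A \<subseteq> U" by auto
    then show "\<exists>A. openin (pervin_topology (topspace \<tau>, \<C>)) A \<and> x \<in> A \<and> A \<subseteq> U"
      using pervin_topology_basic_open[OF A(1)] by metis
  qed
qed

lemma pervin_order_clopen_upsets: "pervin_order (topspace \<tau>, clopen_upsets (\<tau>, r)) = r"
proof
  show "r \<subseteq> pervin_order (topspace \<tau>, clopen_upsets (\<tau>, r))"
    using priestley_order_subset[OF priestley] by (auto simp: pervin_order_def clopen_upsets_def)
  show "pervin_order (topspace \<tau>, clopen_upsets (\<tau>, r)) \<subseteq> r"
  proof (rule subrelI)
    fix x y assume "(x, y) \<in> pervin_order (topspace \<tau>, clopen_upsets (\<tau>, r))"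
    then have "x \<in> topspace \<tau>" "y \<in> topspace \<tau>"
      "\<And>U. U \<in> clopen_upsets (\<tau>, r) \<Longrightarrow> x \<in> U \<Longrightarrow> y \<in> U"
      by (auto simp: pervin_order_def)
    then show "(x, y) \<in> r" using order_separated by metis
  qed
qed

lemma pervin_T0_clopen_upsets: "pervin_T0 (topspace \<tau>, clopen_upsets (\<tau>, r))"
  unfolding pervin_T0_iff[OF pervin_space_clopen_upsets[OF priestley]]
proof (intro ballI impI)
  fix x y assume xy: "x \<in> topspace \<tau>" "y \<in> topspace \<tau>" "x \<noteq> y"
  then have "(x, y) \<notin> r \<or> (y, x) \<notin> r"
    using order_r by (auto simp: partial_order_on_def antisym_def)
  then show "\<exists>U\<in>clopen_upsets (\<tau>, r). (x \<in> U) \<noteq> (y \<in> U)"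
    using order_separated xy by meson
qed

lemma pervin_complete_clopen_upsets: "pervin_complete (topspace \<tau>, clopen_upsets (\<tau>, r))"
proof -
  have "compact_space (pervin_topology (topspace \<tau>, \<C>))"
    using priestley by (simp add: pervin_topology_\<C> priestley_space_def)
  then show ?thesis
    using compact_space_imp_complete[OF alg] pervin_space_clopen_upsets[OF priestley]
    by (simp add: pervin_complete_def symmetrization_def)
qed

end

lemma priestley_hom_imp_pervin_hom:
  assumes r: "priestley_space (\<tau>, r)" and f: "f \<in> priestley_hom (\<tau>, r) (\<sigma>, s)"
  shows "f \<in> pervin_hom (topspace \<tau>, clopen_upsets (\<tau>, r)) (topspace \<sigma>, clopen_upsets (\<sigma>, s))"
proof -
  have fE: "f \<in> topspace \<tau> \<rightarrow>\<^sub>E topspace \<sigma>" and cont: "continuous_map \<tau> \<sigma> f"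
    and "\<forall>(x, y)\<in>r. (f x, f y) \<in> s"
    using f by (simp_all add: priestley_hom_def)
  then have mono: "(f x, f y) \<in> s" if "(x, y) \<in> r" for x y
    using that by blast
  note sub = priestley_order_subset[OF r]
  have "f -` U \<inter> topspace \<tau> \<in> clopen_upsets (\<tau>, r)" if U: "U \<in> clopen_upsets (\<sigma>, s)" for U
  proof -
    have "f -` U \<inter> topspace \<tau> = {x \<in> topspace \<tau>. f x \<in> U}" by auto
    then have "openin \<tau> (f -` U \<inter> topspace \<tau>)" "closedin \<tau> (f -` U \<inter> topspace \<tau>)"
      using U openin_continuous_map_preimage[OF cont] closedin_continuous_map_preimage[OF cont]
      by (auto simp: clopen_upsets_def)
    moreover have "y \<in> f -` U \<inter> topspace \<tau>"
      if "x \<in> f -` U \<inter> topspace \<tau>" "(x, y) \<in> r" for x y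
    proof -
      have "\<forall>x y. x \<in> U \<and> (x, y) \<in> s \<longrightarrow> y \<in> U" using U by (simp add: clopen_upsets_def)
      then have "f y \<in> U" using mono[OF that(2)] that(1) by blast
      then show ?thesis using sub that(2) by blast
    qed
    ultimately show ?thesis unfolding clopen_upsets_def by blast
  qed
  then show ?thesis using fE by (simp add: pervin_hom_def)
qed


section \<open>The isomorphism of categories\<close>

lemma is_category_Pervin: "is_category (Pervin :: ('a pervin, 'a \<Rightarrow> 'a) cat)"
proof -
  have idt: "(\<lambda>x\<in>fst A. x) \<in> pervin_hom A A" if "pervin_space A" for A :: "'a pervin"
  proof -
    obtain X S where A: "A = (X, S)" by force
    have "(\<lambda>x\<in>X. x) -` B \<inter> X = B" if "B \<in> S" for B
    proof -
      have "B \<subseteq> X" using \<open>pervin_space A\<close> that by (auto simp: A pervin_space_def)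
      then show ?thesis by (auto simp: subset_iff)
    qed
    then show ?thesis by (auto simp: A pervin_hom_def)
  qed
  have comp: "compose (fst A) g f \<in> pervin_hom A C"
    if "f \<in> pervin_hom A B" "g \<in> pervin_hom B C" for A B C :: "'a pervin" and f g
  proof -
    obtain X S Y T Z R where eqs: "A = (X, S)" "B = (Y, T)" "C = (Z, R)" by (metis surj_pair)
    have f: "f \<in> X \<rightarrow>\<^sub>E Y" "\<And>B. B \<in> T \<Longrightarrow> f -` B \<inter> X \<in> S"
      and g: "g \<in> Y \<rightarrow>\<^sub>E Z" "\<And>B. B \<in> R \<Longrightarrow> g -` B \<inter> Y \<in> T"
      using that by (auto simp: eqs pervin_hom_def)
    have "compose X g f -` D \<inter> X \<in> S" if "D \<in> R" for D
    proof -
      have "compose X g f -` D \<inter> X = f -` (g -` D \<inter> Y) \<inter> X"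
        using f(1) by (auto simp: compose_def)
      then show ?thesis using f(2)[OF g(2)[OF that]] by metis
    qed
    moreover have "compose X g f \<in> X \<rightarrow>\<^sub>E Z" using f(1) g(1) by (auto simp: compose_def)
    ultimately show ?thesis by (simp add: eqs pervin_hom_def)
  qed
  have homE: "f \<in> fst A \<rightarrow>\<^sub>E fst B" if "f \<in> pervin_hom A B" for A B :: "'a pervin" and f
    using that by (auto simp: pervin_hom_def split: prod.splits)
  show ?thesis
    unfolding is_category_def Pervin_def
    by (simp add: idt comp)
      (auto dest!: homE simp: compose_def fun_eq_iff PiE_def extensional_def)
qed

lemma is_category_full_subcategory: "is_category C \<Longrightarrow> is_category (full_subcategory C P)"
  unfolding is_category_def full_subcategory_def by simp

lemma is_category_Priest: "is_category (Priest :: ('a ordered_space, 'a \<Rightarrow> 'a) cat)"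
proof -
  have idt: "(\<lambda>x\<in>topspace (fst A). x) \<in> priestley_hom A A" if A: "priestley_space A"
    for A :: "'a ordered_space"
  proof -
    obtain \<tau> r where A_eq: "A = (\<tau>, r)" by force
    have "r \<subseteq> topspace \<tau> \<times> topspace \<tau>"
      using A priestley_order_subset by (simp add: A_eq)
    moreover have "continuous_map \<tau> \<tau> (\<lambda>x\<in>topspace \<tau>. x)"
      by (rule continuous_map_eq[OF continuous_map_id]) simp
    ultimately show ?thesis by (auto simp: A_eq priestley_hom_def)
  qed
  have comp: "compose (topspace (fst A)) g f \<in> priestley_hom A C"
    if A: "priestley_space A" and f: "f \<in> priestley_hom A B" and g: "g \<in> priestley_hom B C"
    for A B C :: "'a ordered_space" and f g
  proof -
    obtain \<tau> r \<sigma> s \<rho> t where eqs: "A = (\<tau>, r)" "B = (\<sigma>, s)" "C = (\<rho>, t)" by (metis surj_pair)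
    have "r \<subseteq> topspace \<tau> \<times> topspace \<tau>"
      using A priestley_order_subset by (simp add: eqs)
    then have r_sub: "x \<in> topspace \<tau>" "y \<in> topspace \<tau>" if "(x, y) \<in> r" for x y
      using that by auto
    have "\<forall>(x, y)\<in>r. (f x, f y) \<in> s" "\<forall>(x, y)\<in>s. (g x, g y) \<in> t"
      using f g by (simp_all add: eqs priestley_hom_def)
    then have "(g (f x), g (f y)) \<in> t" if "(x, y) \<in> r" for x y
      using that by blast
    then have "\<forall>(x, y)\<in>r. (compose (topspace \<tau>) g f x, compose (topspace \<tau>) g f y) \<in> t"
      using r_sub by (auto simp: compose_def)
    moreover have "continuous_map \<tau> \<rho> (compose (topspace \<tau>) g f)"
      by (rule continuous_map_eq[of _ _ "g \<circ> f"])
        (use f g in \<open>auto simp: eqs priestley_hom_def compose_def intro: continuous_map_compose\<close>)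
    moreover have "compose (topspace \<tau>) g f \<in> topspace \<tau> \<rightarrow>\<^sub>E topspace \<rho>"
      using f g by (auto simp: eqs priestley_hom_def compose_def)
    ultimately show ?thesis by (simp add: eqs priestley_hom_def)
  qed
  have homE: "f \<in> topspace (fst A) \<rightarrow>\<^sub>E topspace (fst B)" if "f \<in> priestley_hom A B"
    for A B :: "'a ordered_space" and f
    using that by (auto simp: priestley_hom_def split: prod.splits)
  show ?thesis
    unfolding is_category_def Priest_def
    by (simp add: idt comp)
      (auto dest!: homE simp: compose_def fun_eq_iff PiE_def extensional_def)
qed

theorem proposition5p6:
  assumes "prime_ideal_theorem TYPE('a set)"
  shows "category_isomorphism
           (CPervin :: ('a pervin, 'a \<Rightarrow> 'a) cat)
           (Priest :: ('a ordered_space, 'a \<Rightarrow> 'a) cat)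
           P_functor CUp_functor"
proof -
  let ?P = "P_functor :: ('a pervin, 'a \<Rightarrow> 'a, 'a ordered_space, 'a \<Rightarrow> 'a) cat_functor"
  let ?U = "CUp_functor :: ('a ordered_space, 'a \<Rightarrow> 'a, 'a pervin, 'a \<Rightarrow> 'a) cat_functor"
  have ObC: "A \<in> Ob CPervin \<longleftrightarrow> pervin_space A \<and> pervin_T0 A \<and> pervin_complete A"
    for A :: "'a pervin"
    by (simp add: CPervin_def full_subcategory_def Pervin_def)
  have HomC: "Hom CPervin = (pervin_hom :: 'a pervin \<Rightarrow> _)"
    and IdC: "Ident CPervin = (\<lambda>A::'a pervin. \<lambda>x\<in>fst A. x)"
    and CmpC: "Cmp CPervin = (\<lambda>(A::'a pervin) B C g f. compose (fst A) g f)"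
    by (simp_all add: CPervin_def full_subcategory_def Pervin_def)
  have ObP: "A \<in> Ob Priest \<longleftrightarrow> priestley_space A" for A :: "'a ordered_space"
    by (simp add: Priest_def)
  have HomP: "Hom Priest = (priestley_hom :: 'a ordered_space \<Rightarrow> _)"
    and IdP: "Ident Priest = (\<lambda>A::'a ordered_space. \<lambda>x\<in>topspace (fst A). x)"
    and CmpP: "Cmp Priest = (\<lambda>(A::'a ordered_space) B C g f. compose (topspace (fst A)) g f)"
    by (simp_all add: Priest_def)
  have P_ob: "ObMap ?P (X, S) = (pervin_topology (X, boolean_closure (X, S)), pervin_order (X, S))"
    for X S by (simp add: P_functor_def symmetrization_def)
  have U_ob: "ObMap ?U (\<tau>, r) = (topspace \<tau>, clopen_upsets (\<tau>, r))" for \<tau> r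
    by (simp add: CUp_functor_def)
  have homs: "HomMap ?P A B f = f" "HomMap ?U A' B' f = f" for A B A' B' f
    by (simp_all add: P_functor_def CUp_functor_def)
  have cp: "complete_pervin X S" if "(X, S) \<in> Ob CPervin" for X :: "'a set" and S
    using that assms by (simp add: ObC complete_pervin_def)
  have pr: "priestley \<tau> r" if "(\<tau>, r) \<in> Ob Priest" for \<tau> :: "'a topology" and r
    using that by (simp add: ObP priestley_def)
  have catC: "is_category (CPervin :: ('a pervin, 'a \<Rightarrow> 'a) cat)"
    unfolding CPervin_def by (rule is_category_full_subcategory[OF is_category_Pervin])
  have topP: "topspace (fst (ObMap ?P A)) = fst A" if "A \<in> Ob CPervin" for A
    using complete_pervin.topspace_patch[OF cp] that by (cases A) (simp add: P_ob)
  have "is_functor CPervin Priest ?P"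
    unfolding is_functor_def
  proof (intro conjI ballI)
    show "ObMap ?P A \<in> Ob Priest" if "A \<in> Ob CPervin" for A
      using complete_pervin.priestley_space_patch[OF cp] that by (cases A) (simp add: P_ob ObP)
    show "HomMap ?P A B f \<in> Hom Priest (ObMap ?P A) (ObMap ?P B)"
      if "A \<in> Ob CPervin" "B \<in> Ob CPervin" "f \<in> Hom CPervin A B" for A B f
      using that
      by (cases A; cases B)
        (auto simp: P_ob ObC HomC HomP homs intro: pervin_hom_imp_priestley_hom)
  qed (simp_all add: catC is_category_Priest homs IdC IdP CmpC CmpP topP)
  moreover have "is_functor Priest CPervin ?U"
    unfolding is_functor_def
  proof (intro conjI ballI)
    show "ObMap ?U A \<in> Ob CPervin" if "A \<in> Ob Priest" for A
      using priestley.pervin_T0_clopen_upsets[OF pr] priestley.pervin_complete_clopen_upsets[OF pr]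
        pervin_space_clopen_upsets that
      by (cases A) (simp add: U_ob ObC ObP)
    show "HomMap ?U A B f \<in> Hom CPervin (ObMap ?U A) (ObMap ?U B)"
      if "A \<in> Ob Priest" "B \<in> Ob Priest" "f \<in> Hom Priest A B" for A B f
      using that
      by (cases A; cases B) (auto simp: U_ob ObP HomC HomP homs intro: priestley_hom_imp_pervin_hom)
  qed (simp_all add: catC is_category_Priest homs IdC IdP CmpC CmpP CUp_functor_def)
  moreover have "ObMap ?U (ObMap ?P A) = A" if "A \<in> Ob CPervin" for A
    using complete_pervin.clopen_upsets_patch[OF cp] complete_pervin.topspace_patch[OF cp] that
    by (cases A) (simp add: P_ob U_ob)
  moreover have "ObMap ?P (ObMap ?U A) = A" if "A \<in> Ob Priest" for A
    using priestley.pervin_topology_\<C>[OF pr] priestley.pervin_order_clopen_upsets[OF pr] that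
    by (cases A) (simp add: P_ob U_ob)
  ultimately show ?thesis
    by (simp add: category_isomorphism_def left_inverse_functor_def homs)
qed

end
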